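(* For any $\alpha$ with $H<\alpha<1$, a lower bound for the probability of finite-time quenching of the solution $z=(z_1,z_2)^\top$ of the system (Z) of the context is given by $$\mathbb P\{\tau_q<\infty\}\ge1-\exp\left\{-\frac{\alpha^2(L_1(\alpha)-1)^2}{\rho_1^2(2\alpha-1)^{2-\frac1\alpha}\,(\ln(U+1))^{\frac1\alpha-2}+2\rho_2^2\alpha^2\,(\ln(U+1))^{\frac{2H}\alpha-2}\left(\frac{\alpha-H}{\alpha}\right)^{2-\frac{2H}{\alpha}}}\right\},$$ where $U:=\frac{E^3(0)}{12\tilde\lambda}$ and $$L_1(\alpha):=\mathbb E\left[\sup_{t\ge0}\frac{\ln\left(\int_0^t\exp\{3(\chi+k^2)s+\rho_1W(s)+\rho_2B^H(s)\}ds+1\right)+t^\alpha}{\ln\left(\frac{E^3(0)}{12\tilde\lambda}+1\right)+t^\alpha}\right].$$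
   Context: $D\subset\mathbb{R}^d$, $d\ge1$, is a bounded domain with smooth boundary $\partial D$ and outward unit normal $\nu$. The constants $\beta$, $\lambda_{i1},\lambda_{i2}$, $k_{i1},k_{i2}$ ($i=1,2$) are positive. On a filtered probability space $(\Omega,\mathcal F,(\mathcal F_t)_{t\ge0},\mathbb P)$, $W$ is a standard one-dimensional Brownian motion and $B^H$ is a one-dimensional fractional Brownian motion with Hurst index $H\in(1/2,1)$, given by the Volterra representation $B^H(t)=\int_0^tK^H(t,s)dW(s)$ with kernel $K^H(t,s)=C_H\big[\frac{t^{H-1/2}}{s^{H-1/2}}(t-s)^{H-1/2}-(H-\frac12)\int_s^t\frac{u^{H-3/2}}{s^{H-1/2}}(u-s)^{H-1/2}du\big]$, $s\le t$, where $C_H$ is the normalizing constant for which $\mathbb E|B^H(t)|^2=t^{2H}$. $N_i(t):=k_{i1}W(t)+k_{i2}B^H(t)$. $g_i=1-f_i$ with $f_i\in C^2(D)$, $0\le f_i<1$, $f_i\not\equiv0$, so $0<g_i\le1$. Throughout $i=1,2$ and $j\in\{1,2\}\setminus\{i\}$. Parameter condition: $k_{21}+2k_{11}=3k_{11}=:\rho_{11}$, $k_{22}+2k_{12}=3k_{12}=:\rho_{12}$, $k_{11}+2k_{21}=3k_{21}=:\rho_{21}$, $k_{12}+2k_{22}=3k_{22}=:\rho_{22}$, with $\rho_{11}=\rho_{21}=:\rho_1$ and $\rho_{12}=\rho_{22}=:\rho_2$. $(\chi,\psi)$ is the principal eigenpair of $-\Delta\psi=\chi\psi$ in $D$, $\frac{\partial\psi}{\partial\nu}+\beta\psi=0$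 on $\partial D$, with $\chi>0$, $\psi>0$, $\int_D\psi\,dx=1$. Put $k^2:=\min\{\frac{k_{11}^2}{2},\frac{k_{21}^2}{2}\}$, $E(0):=\int_D[g_1+g_2]\psi\,dx$, $\tilde\lambda:=\min\{\lambda_{11}+\lambda_{22},\lambda_{12}+\lambda_{21}\}$. System (Z): $dz_i=[\Delta z_i-\lambda_{i1}z_i^{-2}-\lambda_{i2}z_j^{-2}]dt-z_i\,dN_i(t)$ for $t>0,\ x\in D$ (Itô integral for $W$, pathwise Young integral for $B^H$); $\frac{\partial z_i}{\partial\nu}+\beta z_i=0$ on $\partial D$, $t>0$; $z_i(0,x)=g_i(x)$, $x\in D$. The solution is understood in the weak sense: $z_i=e^{-N_i}v_i$, where, for every $\varphi_i\in C^2(D)$ with $\frac{\partial\varphi_i}{\partial\nu}+\beta\varphi_i=0$ on $\partial D$ and $t<\tau_q$, $\int_Dv_i(t)\varphi_i=\int_Dg_i\varphi_i+\int_0^t\int_Dv_i(s)(\Delta-\frac{k_{i1}^2}{2})\varphi_i\,ds-\lambda_{i1}\int_0^te^{3N_i(s)}\int_Dv_i^{-2}(s)\varphi_i\,ds-\lambda_{i2}\int_0^te^{N_i(s)+2N_j(s)}\int_Dv_j^{-2}(s)\varphi_i\,ds$. $\tau_q$ is the quenching time: the stopping time with $\lim_{t\to\tau_q}\min\{\min_{\bar D}|z_1(t,\cdot)|,\min_{\bar D}|z_2(t,\cdot)|\}=0$ a.s. on $\{\tau_q<\infty\}$, $\tau_q=\infty$ if the solution is global. *)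

theory Defs
  imports "HOL-Probability.Probability"
begin

section \<open>Smooth domains and Robin eigenpairs\<close>

text \<open>\<open>C_k_on k f S\<close> is the class $C^k(S)$; it is meant for open \<open>S\<close>.\<close>

primrec C_k_on :: "nat \<Rightarrow> ('a::euclidean_space \<Rightarrow> real) \<Rightarrow> 'a set \<Rightarrow> bool" where
  "C_k_on 0 f S \<longleftrightarrow> continuous_on S f"
| "C_k_on (Suc k) f S \<longleftrightarrow>
     f differentiable_on S \<and> (\<forall>b\<in>Basis. C_k_on k (\<lambda>x. frechet_derivative f (at x) b) S)"

definition laplacian :: "('a::euclidean_space \<Rightarrow> real) \<Rightarrow> 'a \<Rightarrow> real" where
  "laplacian f x =
     (\<Sum>b\<in>Basis. frechet_derivative (\<lambda>y. frechet_derivative f (at y) b) (at x) b)"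

definition local_defining_function :: "'a::euclidean_space set \<Rightarrow> 'a set \<Rightarrow> ('a \<Rightarrow> real) \<Rightarrow> bool" where
  "local_defining_function D V r \<longleftrightarrow>
     open V \<and> (\<forall>k. C_k_on k r V) \<and> (\<forall>x\<in>V. \<exists>n. n \<noteq> 0 \<and> GDERIV r x :> n) \<and>
     D \<inter> V = {x \<in> V. r x < 0}"

definition smooth_bounded_domain :: "'a::euclidean_space set \<Rightarrow> bool" where
  "smooth_bounded_domain D \<longleftrightarrow>
     D \<noteq> {} \<and> open D \<and> connected D \<and> bounded D \<and>
     (\<forall>p\<in>frontier D. \<exists>V r. p \<in> V \<and> local_defining_function D V r)"

text \<open>The normalised gradient \<open>sgn n = n /\<^sub>R norm n\<close> at a boundary point does not depend on
  the choice of the local defining function, so this determines \<open>\<nu>\<close> on \<open>frontier D\<close>.\<close>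

definition outward_unit_normal :: "'a::euclidean_space set \<Rightarrow> ('a \<Rightarrow> 'a) \<Rightarrow> bool" where
  "outward_unit_normal D \<nu> \<longleftrightarrow>
     (\<forall>p\<in>frontier D. \<forall>V r n. p \<in> V \<and> local_defining_function D V r \<and> GDERIV r p :> n
        \<longrightarrow> \<nu> p = sgn n)"

text \<open>Functions that are $C^2$ up to the boundary (that is, $C^2$ on a neighbourhood of
  \<open>closure D\<close>) and satisfy the Robin condition.\<close>

definition robin_C2 :: "'a::euclidean_space set \<Rightarrow> ('a \<Rightarrow> 'a) \<Rightarrow> real \<Rightarrow> ('a \<Rightarrow> real) \<Rightarrow> bool" where
  "robin_C2 D \<nu> \<beta> \<phi> \<longleftrightarrow>
     (\<exists>V. open V \<and> closure D \<subseteq> V \<and> C_k_on 2 \<phi> V) \<and>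
     (\<forall>x\<in>frontier D. frechet_derivative \<phi> (at x) (\<nu> x) + \<beta> * \<phi> x = 0)"

definition robin_eigenpair ::
  "'a::euclidean_space set \<Rightarrow> ('a \<Rightarrow> 'a) \<Rightarrow> real \<Rightarrow> real \<Rightarrow> ('a \<Rightarrow> real) \<Rightarrow> bool" where
  "robin_eigenpair D \<nu> \<beta> chi \<psi> \<longleftrightarrow>
     robin_C2 D \<nu> \<beta> \<psi> \<and> (\<exists>x\<in>D. \<psi> x \<noteq> 0) \<and> (\<forall>x\<in>D. - laplacian \<psi> x = chi * \<psi> x)"

definition robin_principal_eigenpair ::
  "'a::euclidean_space set \<Rightarrow> ('a \<Rightarrow> 'a) \<Rightarrow> real \<Rightarrow> real \<Rightarrow> ('a \<Rightarrow> real) \<Rightarrow> bool" where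
  "robin_principal_eigenpair D \<nu> \<beta> chi \<psi> \<longleftrightarrow>
     robin_eigenpair D \<nu> \<beta> chi \<psi> \<and> (\<forall>chi' \<psi>'. robin_eigenpair D \<nu> \<beta> chi' \<psi>' \<longrightarrow> chi \<le> chi') \<and>
     chi > 0 \<and> (\<forall>x\<in>D. \<psi> x > 0) \<and> (LINT x:D|lborel. \<psi> x) = 1"


section \<open>Brownian motion and fractional Brownian motion\<close>

text \<open>Processes are indexed by \<open>real\<close> and only matter at times \<open>t \<ge> 0\<close>. Filtrations are indexed by
  \<open>ennreal\<close>, so that the library notion of a stopping time allows the value \<open>\<infinity>\<close>; the additional
  member \<open>F \<infinity>\<close> plays no role.\<close>

definition standard_brownian_motion ::
  "'w measure \<Rightarrow> (ennreal \<Rightarrow> 'w measure) \<Rightarrow> (real \<Rightarrow> 'w \<Rightarrow> real) \<Rightarrow> bool" where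
  "standard_brownian_motion M F W \<longleftrightarrow>
     (\<forall>t\<ge>0. W t \<in> borel_measurable (F (ennreal t))) \<and>
     (AE \<omega> in M. W 0 \<omega> = 0) \<and>
     (AE \<omega> in M. continuous_on {0..} (\<lambda>t. W t \<omega>)) \<and>
     (\<forall>s t. 0 \<le> s \<and> s < t \<longrightarrow>
        distributed M lborel (\<lambda>\<omega>. W t \<omega> - W s \<omega>) (normal_density 0 (sqrt (t - s))) \<and>
        prob_space.indep_set M (sets (F (ennreal s)))
          (sets (vimage_algebra (space M) (\<lambda>\<omega>. W t \<omega> - W s \<omega>) borel)))"

text \<open>A process is centred Gaussian with covariance \<open>R\<close> iff every linear combination of its values
  is \<open>\<N>(0, v)\<close> with \<open>v\<close> the corresponding quadratic form of \<open>R\<close>; the case \<open>v = 0\<close>, where there is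
  no density, is separate.\<close>

definition centred_gaussian_process ::
  "'w measure \<Rightarrow> (real \<Rightarrow> real \<Rightarrow> real) \<Rightarrow> (real \<Rightarrow> 'w \<Rightarrow> real) \<Rightarrow> bool" where
  "centred_gaussian_process M R X \<longleftrightarrow>
     (\<forall>t\<ge>0. X t \<in> borel_measurable M) \<and>
     (\<forall>T c. finite T \<and> T \<subseteq> {0..} \<longrightarrow>
        (let v = (\<Sum>s\<in>T. \<Sum>t\<in>T. c s * c t * R s t); Y = (\<lambda>\<omega>. \<Sum>t\<in>T. c t * X t \<omega>)
         in v \<ge> 0 \<and>
            (if v = 0 then AE \<omega> in M. Y \<omega> = 0
             else distributed M lborel Y (normal_density 0 (sqrt v)))))"

definition fractional_brownian_motion ::
  "'w measure \<Rightarrow> real \<Rightarrow> (real \<Rightarrow> 'w \<Rightarrow> real) \<Rightarrow> bool" where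
  "fractional_brownian_motion M H B \<longleftrightarrow>
     centred_gaussian_process M
       (\<lambda>s t. (s powr (2 * H) + t powr (2 * H) - \<bar>t - s\<bar> powr (2 * H)) / 2) B \<and>
     (AE \<omega> in M. continuous_on {0..} (\<lambda>t. B t \<omega>))"

text \<open>\<open>has_wiener_integral M W T f X\<close>: \<open>X\<close> is (a version of) $\int_0^T f(s)\,dW(s)$ for a
  deterministic $f \in L^2(0,T)$, i.e. the $L^2(\Omega)$-limit of the elementary integrals of step
  functions converging to \<open>f\<close> in $L^2(0,T)$. The \<open>m\<close>-th step function takes the value \<open>c m i\<close> on the
  interval from \<open>p m i\<close> to \<open>p m (Suc i)\<close>, for \<open>i < n m\<close>.\<close>

definition has_wiener_integral ::
  "'w measure \<Rightarrow> (real \<Rightarrow> 'w \<Rightarrow> real) \<Rightarrow> real \<Rightarrow> (real \<Rightarrow> real) \<Rightarrow> ('w \<Rightarrow> real) \<Rightarrow> bool" where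
  "has_wiener_integral M W T f X \<longleftrightarrow>
     set_borel_measurable lborel {0..T} f \<and> X \<in> borel_measurable M \<and>
     (\<exists>(n :: nat \<Rightarrow> nat) (p :: nat \<Rightarrow> nat \<Rightarrow> real) (c :: nat \<Rightarrow> nat \<Rightarrow> real).
        (\<forall>m. p m ` {..n m} \<subseteq> {0..T} \<and> (\<forall>i<n m. p m i \<le> p m (Suc i))) \<and>
        (\<lambda>m. \<integral>\<^sup>+s\<in>{0..T}. ennreal
               (((\<Sum>i<n m. c m i * indicator {p m i<..p m (Suc i)} s) - f s)\<^sup>2) \<partial>lborel)
          \<longlonglongrightarrow> 0 \<and>
        (\<lambda>m. \<integral>\<^sup>+\<omega>. ennreal
               (((\<Sum>i<n m. c m i * (W (p m (Suc i)) \<omega> - W (p m i) \<omega>)) - X \<omega>)\<^sup>2) \<partial>M)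
          \<longlonglongrightarrow> 0)"

definition volterra_kernel :: "real \<Rightarrow> real \<Rightarrow> real \<Rightarrow> real \<Rightarrow> real" where
  "volterra_kernel C H t s =
     C * (t powr (H - 1/2) / s powr (H - 1/2) * (t - s) powr (H - 1/2)
          - (H - 1/2) * (LINT u:{s..t}|lborel.
              u powr (H - 3/2) / s powr (H - 1/2) * (u - s) powr (H - 1/2)))"

text \<open>The requirement on the second moment determines the normalising constant \<open>C\<close> uniquely.\<close>

definition volterra_representation ::
  "'w measure \<Rightarrow> (real \<Rightarrow> 'w \<Rightarrow> real) \<Rightarrow> real \<Rightarrow> (real \<Rightarrow> 'w \<Rightarrow> real) \<Rightarrow> bool" where
  "volterra_representation M W H B \<longleftrightarrow>
     (\<exists>C>0. \<forall>t\<ge>0. has_wiener_integral M W t (volterra_kernel C H t) (B t) \<and>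
        (\<integral>\<omega>. \<bar>B t \<omega>\<bar>\<^sup>2 \<partial>M) = t powr (2 * H))"


section \<open>The system and its quenching time\<close>

definition mixed_noise ::
  "(nat \<Rightarrow> nat \<Rightarrow> real) \<Rightarrow> (real \<Rightarrow> 'w \<Rightarrow> real) \<Rightarrow> (real \<Rightarrow> 'w \<Rightarrow> real) \<Rightarrow> nat \<Rightarrow> real \<Rightarrow> 'w \<Rightarrow> real" where
  "mixed_noise k W B i t \<omega> = k i 1 * W t \<omega> + k i 2 * B t \<omega>"

text \<open>One path \<open>z\<close> of a weak solution on $[0,T)$, for a noise path \<open>N\<close>; components are indexed
  by \<open>i \<in> {1, 2}\<close>. The data \<open>g\<close> are only given on the open set \<open>D\<close>, hence the values of \<open>z\<close> at
  time 0 are prescribed on \<open>D\<close> only and continuity up to the boundary is asked for positive times.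
  The \<open>set_integrable\<close> conditions say that the time integrals in the weak formulation exist; the
  Bochner integral would be 0 otherwise.\<close>

definition weak_solution_path ::
  "'a::euclidean_space set \<Rightarrow> ('a \<Rightarrow> 'a) \<Rightarrow> real \<Rightarrow> (nat \<Rightarrow> nat \<Rightarrow> real) \<Rightarrow> (nat \<Rightarrow> nat \<Rightarrow> real) \<Rightarrow>
   (nat \<Rightarrow> 'a \<Rightarrow> real) \<Rightarrow> (nat \<Rightarrow> real \<Rightarrow> real) \<Rightarrow> ennreal \<Rightarrow> (nat \<Rightarrow> real \<Rightarrow> 'a \<Rightarrow> real) \<Rightarrow> bool" where
  "weak_solution_path D \<nu> \<beta> lam k g N T z \<longleftrightarrow>
     (\<forall>i\<in>{1,2}. \<forall>x\<in>D. z i 0 x = g i x) \<and>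
     (\<forall>i\<in>{1,2}. \<forall>t>0. ennreal t < T \<longrightarrow> continuous_on (closure D) (z i t)) \<and>
     (\<exists>v :: nat \<Rightarrow> real \<Rightarrow> 'a \<Rightarrow> real.
        (\<forall>i\<in>{1,2}. \<forall>t\<ge>0. \<forall>x\<in>closure D. ennreal t < T \<longrightarrow> z i t x = exp (- N i t) * v i t x) \<and>
        (\<forall>i\<in>{1,2}. \<forall>j\<in>{1,2} - {i}. \<forall>\<phi>. robin_C2 D \<nu> \<beta> \<phi> \<longrightarrow> (\<forall>t\<ge>0. ennreal t < T \<longrightarrow>
           set_integrable lborel {0..t}
             (\<lambda>s. LINT x:D|lborel. v i s x * (laplacian \<phi> x - (k i 1)\<^sup>2 / 2 * \<phi> x)) \<and>
           set_integrable lborel {0..t}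
             (\<lambda>s. exp (3 * N i s) * (LINT x:D|lborel. \<phi> x / (v i s x)\<^sup>2)) \<and>
           set_integrable lborel {0..t}
             (\<lambda>s. exp (N i s + 2 * N j s) * (LINT x:D|lborel. \<phi> x / (v j s x)\<^sup>2)) \<and>
           (LINT x:D|lborel. v i t x * \<phi> x) =
             (LINT x:D|lborel. g i x * \<phi> x)
             + (LINT s:{0..t}|lborel.
                  LINT x:D|lborel. v i s x * (laplacian \<phi> x - (k i 1)\<^sup>2 / 2 * \<phi> x))
             - lam i 1 * (LINT s:{0..t}|lborel.
                  exp (3 * N i s) * (LINT x:D|lborel. \<phi> x / (v i s x)\<^sup>2))
             - lam i 2 * (LINT s:{0..t}|lborel.
                  exp (N i s + 2 * N j s) * (LINT x:D|lborel. \<phi> x / (v j s x)\<^sup>2)))))"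

definition min_abs_on_closure :: "'a::euclidean_space set \<Rightarrow> ('a \<Rightarrow> real) \<Rightarrow> real" where
  "min_abs_on_closure D u = (INF x\<in>closure D. \<bar>u x\<bar>)"

text \<open>\<open>\<tau>\<close> is the first time at which \<open>min {min |z\<^sub>1|, min |z\<^sub>2|}\<close> vanishes: it is positive before
  \<open>\<tau>\<close> and tends to 0 at \<open>\<tau>\<close> if \<open>\<tau> < \<infinity>\<close>. Together with \<open>weak_solution_path\<close> up to \<open>\<tau>\<close>, the
  case \<open>\<tau> = \<infinity>\<close> is exactly that of a global solution.\<close>

definition quenching_time ::
  "'w measure \<Rightarrow> (ennreal \<Rightarrow> 'w measure) \<Rightarrow> 'a::euclidean_space set \<Rightarrow>
   (nat \<Rightarrow> real \<Rightarrow> 'a \<Rightarrow> 'w \<Rightarrow> real) \<Rightarrow> ('w \<Rightarrow> ennreal) \<Rightarrow> bool" where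
  "quenching_time M F D z \<tau> \<longleftrightarrow>
     stopping_time F \<tau> \<and>
     (AE \<omega> in M.
        (\<forall>t>0. ennreal t < \<tau> \<omega> \<longrightarrow>
           0 < min (min_abs_on_closure D (\<lambda>x. z 1 t x \<omega>)) (min_abs_on_closure D (\<lambda>x. z 2 t x \<omega>))) \<and>
        (\<tau> \<omega> < \<infinity> \<longrightarrow>
           ((\<lambda>t. min (min_abs_on_closure D (\<lambda>x. z 1 t x \<omega>)) (min_abs_on_closure D (\<lambda>x. z 2 t x \<omega>)))
              \<longlongrightarrow> 0) (at (enn2real (\<tau> \<omega>)) within {0..<enn2real (\<tau> \<omega>)})))"


section \<open>The quantities in the bound\<close>

text \<open>\<open>L\<^sub>1(\<alpha>)\<close> is the expectation of a nonnegative random variable and is taken in $[0,\infty]$; it is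
  not assumed to be finite.\<close>

definition L1 ::
  "'w measure \<Rightarrow> (real \<Rightarrow> 'w \<Rightarrow> real) \<Rightarrow> (real \<Rightarrow> 'w \<Rightarrow> real) \<Rightarrow>
   real \<Rightarrow> real \<Rightarrow> real \<Rightarrow> real \<Rightarrow> real \<Rightarrow> ennreal" where
  "L1 M W B a \<rho>1 \<rho>2 U \<alpha> =
     (\<integral>\<^sup>+\<omega>. (SUP t\<in>{0..}. ennreal
        ((ln ((LINT s:{0..t}|lborel. exp (3 * a * s + \<rho>1 * W s \<omega> + \<rho>2 * B s \<omega>)) + 1) + t powr \<alpha>)
          / (ln (U + 1) + t powr \<alpha>))) \<partial>M)"

text \<open>The continuous extension of \<open>exp\<close> to the extended reals, so that the bound makes sense also
  when \<open>L\<^sub>1(\<alpha>) = \<infinity>\<close>.\<close>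

definition exp_ereal :: "ereal \<Rightarrow> ereal" where
  "exp_ereal x = (if x = \<infinity> then \<infinity> else if x = -\<infinity> then 0 else ereal (exp (real_of_ereal x)))"

end

theory Submission
  imports Defs "HOL-Real_Asymp.Real_Asymp"
begin

text \<open>Quenching is in fact almost sure, which gives the bound because \<open>exp_ereal\<close> is nonnegative.
  Let \<open>e(t) = \<integral> v\<^sub>1(t) \<psi>\<close> along a global path and \<open>\<kappa> = chi + k\<^sub>1\<^sub>1\<^sup>2 / 2\<close>. The weak formulation and
  Jensen's inequality for \<open>y \<mapsto> y\<^sup>-\<^sup>2\<close> give \<open>e' \<le> - \<kappa> e - \<lambda>\<^sub>1\<^sub>1 e\<^sup>-\<^sup>2 exp (3 N\<^sub>1)\<close> in integrated form, so that
  \<open>e(n)\<close> decays geometrically and \<open>\<integral> exp (3 N\<^sub>1)\<close> over \<open>[n, n + 1]\<close> is bounded by a multiple of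
  \<open>(1 + \<kappa>)\<^sup>-\<^sup>3\<^sup>n\<close>. Hence the mean of \<open>\<bar>3 N\<^sub>1\<bar>\<close> over \<open>[n, n + 1]\<close> grows at least linearly in \<open>n\<close>,
  whereas its expectation is only of order \<open>n\<^sup>H\<close>; by Fatou's lemma this is a null event.\<close>

lemma exp_ereal_nonneg: "0 \<le> exp_ereal x"
  by (simp add: exp_ereal_def)

section \<open>Jensen's inequality for the inverse square\<close>

text \<open>The left side is the tangent at \<open>m\<close> of the convex function
  \<open>1 / y\<^sup>2\<close>; after clearing denominators the gap is
  \<open>(y - m)\<^sup>2 * (2 * y + m)\<close>.\<close>

lemma inverse_square_tangent:
  fixes m y :: real
  assumes "m > 0" "y > 0"
  shows "3 / m\<^sup>2 - 2 * y / m ^ 3 \<le> 1 / y\<^sup>2"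
proof -
  have "0 \<le> (y - m)\<^sup>2 * (2 * y + m)"
    using assms by simp
  also have "\<dots> = m ^ 3 - (3 * m - 2 * y) * y\<^sup>2"
    by (simp add: power2_eq_square power3_eq_cube algebra_simps)
  finally have "(3 * m - 2 * y) * y\<^sup>2 \<le> m ^ 3"
    by simp
  then show ?thesis
    using assms by (simp add: field_simps power2_eq_square power3_eq_cube)
qed

text \<open>A zero integral would make \<open>h\<close> vanish almost everywhere on
  \<open>D\<close>, so \<open>D\<close> would be a null set, which no nonempty open set is.\<close>

lemma set_integral_pos:
  fixes h :: "'a::euclidean_space \<Rightarrow> real"
  assumes "open D" "D \<noteq> {}" "set_integrable lborel D h" "\<And>x. x \<in> D \<Longrightarrow> h x > 0"
  shows "(LINT x:D|lborel. h x) > 0"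
proof -
  have ge: "(LINT x:D|lborel. h x) \<ge> 0"
    unfolding set_lebesgue_integral_def
    using assms(4) by (intro integral_nonneg_AE AE_I2) (auto simp: indicator_def intro: less_imp_le)
  have "(LINT x:D|lborel. h x) \<noteq> 0"
  proof
    assume "(LINT x:D|lborel. h x) = 0"
    then have "AE x in lborel. indicator D x *\<^sub>R h x = 0"
      using assms(3,4) unfolding set_lebesgue_integral_def set_integrable_def
      by (subst (asm) integral_nonneg_eq_0_iff_AE)
        (auto simp: indicator_def intro: less_imp_le)
    then have "AE x in lborel. x \<notin> D"
      by eventually_elim (use assms(4) in \<open>force simp: indicator_def\<close>)
    then have "D \<in> null_sets lborel"
      using assms(1) by (subst (asm) AE_iff_null_sets[symmetric]) auto
    then have "negligible D"
      using negligible_iff_null_sets null_sets_completionI by blast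
    then show False
      using assms(1,2) open_not_negligible by blast
  qed
  with ge show ?thesis by linarith
qed

lemma set_integrable_bounded_continuous_mult:
  fixes w h :: "'a::euclidean_space \<Rightarrow> real"
  assumes "open D" "set_integrable lborel D w" "continuous_on D h" "\<And>x. x \<in> D \<Longrightarrow> \<bar>h x\<bar> \<le> c"
  shows "set_integrable lborel D (\<lambda>x. h x * w x)"
proof -
  have meas: "set_borel_measurable lborel D h"
    using borel_measurable_continuous_on_indicator[of D h] assms(1,3)
    by (simp add: set_borel_measurable_def)
  have "integrable lborel (\<lambda>x. (indicator D x *\<^sub>R h x) * (indicator D x *\<^sub>R w x))"
  proof (rule Bochner_Integration.integrable_bound)
    show "integrable lborel (\<lambda>x. c * (indicator D x *\<^sub>R w x))"
      using assms(2) by (simp add: set_integrable_def)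
    show "(\<lambda>x. (indicator D x *\<^sub>R h x) * (indicator D x *\<^sub>R w x)) \<in> borel_measurable lborel"
      using meas assms(2) unfolding set_borel_measurable_def set_integrable_def
      by (intro borel_measurable_times) auto
    show "AE x in lborel. norm ((indicator D x *\<^sub>R h x) * (indicator D x *\<^sub>R w x))
        \<le> norm (c * (indicator D x *\<^sub>R w x))"
    proof (rule AE_I2)
      fix x
      show "norm ((indicator D x *\<^sub>R h x) * (indicator D x *\<^sub>R w x))
        \<le> norm (c * (indicator D x *\<^sub>R w x))"
        using assms(4)[of x] by (auto simp: indicator_def abs_mult intro!: mult_right_mono)
    qed
  qed
  also have "(\<lambda>x. (indicator D x *\<^sub>R h x) * (indicator D x *\<^sub>R w x))
      = (\<lambda>x. indicator D x *\<^sub>R (h x * w x))"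
    by (auto simp: indicator_def)
  finally show ?thesis
    unfolding set_integrable_def .
qed

text \<open>With \<open>w\<close> as a probability density, the tangent inequality at the mean
  \<open>?m\<close> of \<open>v\<close> is integrated against \<open>w\<close>. Compactness of
  \<open>closure D\<close> bounds \<open>v\<close> and its inverse square, so all integrals involved
  exist.\<close>

lemma jensen_inverse_square:
  fixes v w :: "'a::euclidean_space \<Rightarrow> real"
  assumes D: "open D" "D \<noteq> {}" "bounded D"
    and w: "set_integrable lborel D w" "\<And>x. x \<in> D \<Longrightarrow> w x > 0" "(LINT x:D|lborel. w x) = 1"
    and v: "continuous_on (closure D) v" "\<And>x. x \<in> closure D \<Longrightarrow> v x > 0"
  shows "(LINT x:D|lborel. v x * w x) > 0"
    and "1 / (LINT x:D|lborel. v x * w x)\<^sup>2 \<le> (LINT x:D|lborel. w x / (v x)\<^sup>2)"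
proof -
  have cpt: "compact (closure D)"
    using D(3) by (simp add: compact_closure)
  have sub: "D \<subseteq> closure D"
    by (rule closure_subset)
  have int: "set_integrable lborel D (\<lambda>x. h x * w x)"
    if h: "continuous_on (closure D) h" for h :: "'a \<Rightarrow> real"
  proof -
    obtain c where "\<And>x. x \<in> closure D \<Longrightarrow> \<bar>h x\<bar> \<le> c"
      using compact_imp_bounded[OF compact_continuous_image[OF h cpt]]
      by (auto simp: bounded_iff)
    then show ?thesis
      using sub by (intro set_integrable_bounded_continuous_mult[where c = c]
          continuous_on_subset[OF h] D w) auto
  qed
  have cont2: "continuous_on (closure D) (\<lambda>x. 1 / (v x)\<^sup>2)"
    using v by (intro continuous_intros) force+
  have int1: "set_integrable lborel D (\<lambda>x. v x * w x)"
    by (rule int[OF v(1)])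
  have int2: "set_integrable lborel D (\<lambda>x. w x / (v x)\<^sup>2)"
    using int[OF cont2] by simp
  let ?m = "LINT x:D|lborel. v x * w x"
  show pos: "?m > 0"
    using D int1 v(2) w(2) sub by (intro set_integral_pos) auto
  \<comment> \<open>The total mass 1 and the mean \<open>?m\<close> reduce the integrated tangent to
    its value at the point of contact, \<open>3 / ?m\<^sup>2 - 2 / ?m\<^sup>2\<close>.\<close>
  have "1 / ?m\<^sup>2 = 3 / ?m\<^sup>2 * (LINT x:D|lborel. w x) - 2 / ?m ^ 3 * ?m"
    using pos w(3) by (simp add: field_simps power2_eq_square power3_eq_cube)
  also have "\<dots> = (LINT x:D|lborel. 3 / ?m\<^sup>2 * w x - 2 / ?m ^ 3 * (v x * w x))"
    using w(1) int1 by (subst set_integral_diff) auto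
  also have "\<dots> \<le> (LINT x:D|lborel. w x / (v x)\<^sup>2)"
  proof (rule set_integral_mono)
    show "set_integrable lborel D (\<lambda>x. 3 / ?m\<^sup>2 * w x - 2 / ?m ^ 3 * (v x * w x))"
      using w(1) int1 by (intro set_integral_diff(1)) auto
    fix x assume "x \<in> D"
    then have "(3 / ?m\<^sup>2 - 2 * v x / ?m ^ 3) * w x \<le> 1 / (v x)\<^sup>2 * w x"
      using pos v(2) w(2) sub
      by (intro mult_right_mono inverse_square_tangent) (auto intro: less_imp_le)
    then show "3 / ?m\<^sup>2 * w x - 2 / ?m ^ 3 * (v x * w x) \<le> w x / (v x)\<^sup>2"
      by (simp add: algebra_simps)
  qed (rule int2)
  finally show "1 / ?m\<^sup>2 \<le> (LINT x:D|lborel. w x / (v x)\<^sup>2)" .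
qed

section \<open>A dissipation inequality and its decay rate\<close>

text \<open>Here \<open>e\<close> is a positive mass lost at rate \<open>p\<close>. The part
  \<open>\<kappa> * e\<close> of the rate forces geometric decay of \<open>e\<close>. The part with
  \<open>Y\<close> cannot remove more than the mass still present, so the integral of
  \<open>Y\<close> over a unit interval is at most \<open>e\<^sup>3 / l\<close> at its left end and
  decays with the cube of \<open>e\<close>.\<close>

lemma dissipation_integral_decay:
  fixes e p Y :: "real \<Rightarrow> real"
  assumes kappa: "\<kappa> > 0" and lam: "l > 0"
    and int: "\<And>t. t \<ge> 0 \<Longrightarrow> p integrable_on {0..t}"
    and eq: "\<And>t. t \<ge> 0 \<Longrightarrow> e t = G - integral {0..t} p"
    and pos: "\<And>t. t \<ge> 0 \<Longrightarrow> e t > 0"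
    and bound: "\<And>s. s > 0 \<Longrightarrow> \<kappa> * e s + l * Y s / (e s)\<^sup>2 \<le> p s"
    and Y: "continuous_on {0..} Y" "\<And>s. s \<ge> 0 \<Longrightarrow> Y s \<ge> 0"
  obtains C where
    "\<And>n. exp (3 * ln (1 + \<kappa>) * real n) * integral {real (Suc n)..real (Suc n) + 1} Y \<le> C"
proof -
  have int': "p integrable_on {s..t}" if "0 \<le> s" for s t
    using int[of "max 0 t"] that by (rule_tac integrable_subinterval_real) auto
  have diff: "e s - e t = integral {s..t} p" if "0 \<le> s" "s \<le> t" for s t
    using Henstock_Kurzweil_Integration.integral_combine[of 0 s t p] that int[of t] eq[of s] eq[of t]
    by auto
  have p0: "p s \<ge> 0" if "s > 0" for s
  proof -
    have "0 \<le> \<kappa> * e s + l * Y s / (e s)\<^sup>2"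
      using that kappa lam pos[of s] Y(2)[of s] by simp
    with bound[OF that] show ?thesis by linarith
  qed
  have anti: "e t \<le> e s" if "0 < s" "s \<le> t" for s t
  proof -
    have "0 \<le> integral {s..t} p"
      using that int' by (intro Henstock_Kurzweil_Integration.integral_nonneg) (auto intro: p0)
    with diff[of s t] that show ?thesis by simp
  qed
  have Yint: "Y integrable_on {s..t}" if "0 \<le> s" for s t
    using that by (intro integrable_continuous_interval continuous_on_subset[OF Y(1)]) auto
  \<comment> \<open>The unit intervals start at 1 rather than 0 because \<open>bound\<close>, and
    with it \<open>anti\<close>, holds at positive times only.\<close>
  define I where "I n = integral {real (Suc n)..real (Suc n) + 1} Y" for n
  have I0: "I n \<ge> 0" for n
    unfolding I_def by (intro Henstock_Kurzweil_Integration.integral_nonneg Yint Y(2)) auto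
  \<comment> \<open>By monotonicity \<open>e\<close> stays between its endpoint values: the right
    one bounds the linear loss from below, the left one bounds \<open>1 / e\<^sup>2\<close> from
    below.\<close>
  have step: "\<kappa> * e (real (Suc n) + 1) + l / (e (real (Suc n)))\<^sup>2 * I n
      \<le> e (real (Suc n)) - e (real (Suc n) + 1)" for n
  proof -
    let ?a = "real (Suc n)"
    have "((\<lambda>s. \<kappa> * e (?a + 1) + l / (e ?a)\<^sup>2 * Y s) has_integral
        \<kappa> * e (?a + 1) + l / (e ?a)\<^sup>2 * I n) {?a..?a+1}"
      using has_integral_add[OF has_integral_const_real[of "\<kappa> * e (?a + 1)" ?a "?a + 1"]
        has_integral_mult_right[OF integrable_integral[OF Yint[of ?a "?a+1"]], of "l / (e ?a)\<^sup>2"]]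
      by (simp add: I_def)
    moreover have "(p has_integral (e ?a - e (?a + 1))) {?a..?a+1}"
      using diff[of ?a "?a+1"] int'[of ?a "?a+1"] by (metis add_increasing2 integrable_integral
          le_add_same_cancel1 of_nat_0_le_iff zero_le_one)
    ultimately show ?thesis
    proof (rule has_integral_le)
      fix s assume s: "s \<in> {?a..?a+1}"
      then have s0: "s > 0" by auto
      have "e (?a + 1) \<le> e s" "e s \<le> e ?a"
        using s s0 by (auto intro!: anti)
      moreover have "l * Y s / (e ?a)\<^sup>2 \<le> l * Y s / (e s)\<^sup>2"
        using calculation pos[of s] s0 lam Y(2)[of s]
        by (intro divide_left_mono power_mono) auto
      ultimately have "\<kappa> * e (?a + 1) + l / (e ?a)\<^sup>2 * Y s \<le> \<kappa> * e s + l * Y s / (e s)\<^sup>2"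
        using kappa by (intro add_mono mult_left_mono) auto
      also have "\<dots> \<le> p s" by (rule bound[OF s0])
      finally show "\<kappa> * e (?a + 1) + l / (e ?a)\<^sup>2 * Y s \<le> p s" .
    qed
  qed
  \<comment> \<open>Dropping the nonnegative \<open>Y\<close> term of \<open>step\<close> leaves one
    factor \<open>1 + \<kappa>\<close> per unit of time.\<close>
  have decay: "(1 + \<kappa>) ^ n * e (real (Suc n)) \<le> e 1" for n
  proof (induction n)
    case (Suc n)
    have "0 \<le> l / (e (real (Suc n)))\<^sup>2 * I n"
      using lam I0 by simp
    with step[of n] have "(1 + \<kappa>) * e (real (Suc (Suc n))) \<le> e (real (Suc n))"
      by (simp add: algebra_simps)
    then have "(1 + \<kappa>) ^ n * ((1 + \<kappa>) * e (real (Suc (Suc n)))) \<le> (1 + \<kappa>) ^ n * e (real (Suc n))"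
      using kappa by (intro mult_left_mono) auto
    with Suc.IH show ?case by (simp add: mult_ac)
  qed simp
  have "exp (3 * ln (1 + \<kappa>) * real n) * I n \<le> (e 1) ^ 3 / l" for n
  proof -
    have en: "e (real (Suc n)) > 0" "e (real (Suc n) + 1) > 0"
      using pos by auto
    \<comment> \<open>Now the \<open>Y\<close> term of \<open>step\<close> is kept instead. Solving
      for \<open>I n\<close> produces the cube of \<open>e\<close>, which is the source of the
      factor 3 in the rate.\<close>
    have "l / (e (real (Suc n)))\<^sup>2 * I n \<le> e (real (Suc n))"
      using step[of n] en kappa mult_pos_pos[OF kappa en(2)] by linarith
    then have In: "I n \<le> (e (real (Suc n))) ^ 3 / l"
      using en lam by (simp add: field_simps power2_eq_square power3_eq_cube)
    have pw: "exp (3 * ln (1 + \<kappa>) * real n) = ((1 + \<kappa>) ^ n) ^ 3"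
    proof -
      have "exp (3 * ln (1 + \<kappa>) * real n) = exp (real (n * 3) * ln (1 + \<kappa>))"
        by (simp add: mult_ac)
      also have "\<dots> = (1 + \<kappa>) ^ (n * 3)"
        using kappa by (subst exp_of_nat_mult) simp
      finally show ?thesis by (simp add: power_mult)
    qed
    have "exp (3 * ln (1 + \<kappa>) * real n) * I n
        \<le> ((1 + \<kappa>) ^ n) ^ 3 * ((e (real (Suc n))) ^ 3 / l)"
      unfolding pw using kappa by (intro mult_left_mono In) auto
    also have "\<dots> = ((1 + \<kappa>) ^ n * e (real (Suc n))) ^ 3 / l"
      by (simp add: power_mult_distrib)
    also have "\<dots> \<le> (e 1) ^ 3 / l"
      using decay[of n] en kappa lam by (intro divide_right_mono power_mono) auto
    finally show ?thesis .
  qed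
  then show thesis
    using that unfolding I_def by blast
qed

section \<open>Processes whose first absolute moment grows sublinearly\<close>

text \<open>The first absolute moment is exactly \<open>\<sigma> * sqrt (2 / pi)\<close>, and
  \<open>2 / pi \<le> 1\<close>.\<close>

lemma normal_abs_moment_le:
  fixes Y :: "'w \<Rightarrow> real"
  assumes s: "\<sigma> > 0" and D: "distributed M lborel Y (normal_density 0 \<sigma>)"
  shows "(\<integral>\<^sup>+\<omega>. ennreal \<bar>Y \<omega>\<bar> \<partial>M) \<le> ennreal \<sigma>"
proof -
  have "has_bochner_integral lborel (\<lambda>x. normal_density 0 \<sigma> x * \<bar>x\<bar>) (\<sigma> * sqrt (2 / pi))"
    using normal_moment_abs_odd[OF s, of 0 0] by simp
  then have "(\<integral>\<^sup>+x. ennreal (normal_density 0 \<sigma> x * \<bar>x\<bar>) \<partial>lborel) = ennreal (\<sigma> * sqrt (2 / pi))"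
    by (simp add: has_bochner_integral_iff nn_integral_eq_integral)
  moreover
  have "sqrt (2 / pi) \<le> 1"
    using pi_ge_two by (simp add: real_sqrt_le_1_iff)
  then have "\<sigma> * sqrt (2 / pi) \<le> \<sigma>"
    using s by (simp add: mult_le_cancel_left1)
  ultimately show ?thesis
    using distributed_nn_integral[OF D, of "\<lambda>x. ennreal \<bar>x\<bar>"]
    by (simp add: ennreal_mult'[symmetric]) (metis ennreal_leI)
qed

text \<open>The process is recovered as the limit of its values on the grid of mesh \<open>1 / (m + 1)\<close>.\<close>

lemma continuous_process_measurable_version:
  fixes X :: "real \<Rightarrow> 'w \<Rightarrow> real"
  assumes X: "\<And>t. t \<ge> 0 \<Longrightarrow> X t \<in> borel_measurable M"
  obtains X' where "(\<lambda>(t, \<omega>). X' t \<omega>) \<in> borel_measurable (lborel \<Otimes>\<^sub>M M)"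
    and "\<And>t \<omega>. t \<ge> 0 \<Longrightarrow> continuous_on {0..} (\<lambda>t. X t \<omega>) \<Longrightarrow> X' t \<omega> = X t \<omega>"
proof -
  \<comment> \<open>For \<open>t \<ge> 0\<close> this rounds \<open>t\<close> down to the grid. The
    numerator is a natural number, so joint measurability reduces to countably many fixed
    times.\<close>
  define q where "q m t = real (nat \<lfloor>real (Suc m) * t\<rfloor>) / real (Suc m)" for m and t :: real
  \<comment> \<open>\<open>lim\<close> is a total function, so \<open>X'\<close> is jointly
    measurable without an exceptional set; on discontinuous paths it need not agree with
    \<open>X\<close>.\<close>
  define X' where "X' t \<omega> = lim (\<lambda>m. X (q m t) \<omega>)" for t \<omega>
  have "(\<lambda>p. X (q m (fst p)) (snd p)) \<in> borel_measurable (lborel \<Otimes>\<^sub>M M)" for m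
    unfolding q_def
  proof (rule measurable_compose_countable[where g = "\<lambda>p. nat \<lfloor>real (Suc m) * fst p\<rfloor>"
        and f = "\<lambda>i p. X (real i / real (Suc m)) (snd p)"])
    show "(\<lambda>p. X (real i / real (Suc m)) (snd p)) \<in> borel_measurable (lborel \<Otimes>\<^sub>M M)" for i
      by (rule measurable_compose[OF measurable_snd X]) simp
  qed measurable
  then have "(\<lambda>p. X' (fst p) (snd p)) \<in> borel_measurable (lborel \<Otimes>\<^sub>M M)"
    unfolding X'_def by (rule borel_measurable_lim_metric)
  moreover have "X' t \<omega> = X t \<omega>" if t: "t \<ge> 0" and cont: "continuous_on {0..} (\<lambda>t. X t \<omega>)" for t \<omega>
  proof -
    have qt: "q m t = real_of_int \<lfloor>real (Suc m) * t\<rfloor> / real (Suc m)" for m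
      using t by (simp add: q_def)
    have "(\<lambda>m. q m t) \<longlonglongrightarrow> t"
    proof (rule tendsto_sandwich)
      show "\<forall>\<^sub>F m in sequentially. t - 1 / real (Suc m) \<le> q m t"
      proof (rule always_eventually, rule allI)
        fix m
        have "real (Suc m) * t - 1 \<le> real_of_int \<lfloor>real (Suc m) * t\<rfloor>"
          by linarith
        then have "(real (Suc m) * t - 1) / real (Suc m) \<le> q m t"
          unfolding qt by (intro divide_right_mono) auto
        then show "t - 1 / real (Suc m) \<le> q m t"
          by (simp add: diff_divide_distrib)
      qed
      show "\<forall>\<^sub>F m in sequentially. q m t \<le> t"
      proof (rule always_eventually, rule allI)
        fix m
        have "q m t \<le> (real (Suc m) * t) / real (Suc m)"
          unfolding qt by (intro divide_right_mono of_int_floor_le) auto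
        then show "q m t \<le> t" by simp
      qed
      show "(\<lambda>m. t - 1 / real (Suc m)) \<longlonglongrightarrow> t"
        by real_asymp
    qed simp
    then have "(\<lambda>m. X (q m t) \<omega>) \<longlonglongrightarrow> X t \<omega>"
      using t by (intro continuous_on_tendsto_compose[OF cont]) (auto simp: q_def)
    then show ?thesis
      by (simp add: X'_def limI)
  qed
  ultimately show thesis
    by (intro that[of X']) (simp_all add: case_prod_unfold)
qed

text \<open>Divided by \<open>Suc n\<close>, the mean over the unit interval has expectation of
  order \<open>n powr (H - 1)\<close>. Fatou's lemma makes its lower limit 0 almost surely, whereas
  the excluded growth would keep it at least \<open>b\<close>. A lower limit suffices because that
  growth is demanded for every \<open>n\<close>.\<close>

lemma (in prob_space) sublinear_process_mean:
  fixes X :: "real \<Rightarrow> 'a \<Rightarrow> real"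
  assumes X: "\<And>t. t \<ge> 0 \<Longrightarrow> X t \<in> borel_measurable M"
    and cont: "AE \<omega> in M. continuous_on {0..} (\<lambda>t. X t \<omega>)"
    and moment: "\<And>t. t > 0 \<Longrightarrow> (\<integral>\<^sup>+\<omega>. ennreal \<bar>X t \<omega>\<bar> \<partial>M) \<le> ennreal (K * (1 + t) powr H)"
    and H: "0 < H" "H < 1" and b: "b > 0" and K: "K \<ge> 0"
  shows "AE \<omega> in M. \<not> (\<exists>C. \<forall>n. b * real n - C
           \<le> integral {real (Suc n)..real (Suc n) + 1} (\<lambda>s. \<bar>X s \<omega>\<bar>))"
proof -
  obtain X' where X'[measurable]: "(\<lambda>(t, \<omega>). X' t \<omega>) \<in> borel_measurable (lborel \<Otimes>\<^sub>M M)"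
    and eq: "\<And>t \<omega>. t \<ge> 0 \<Longrightarrow> continuous_on {0..} (\<lambda>t. X t \<omega>) \<Longrightarrow> X' t \<omega> = X t \<omega>"
    using continuous_process_measurable_version[where M = M and X = X] X by blast
  interpret P: pair_sigma_finite lborel M
    by standard
  \<comment> \<open>The jointly measurable \<open>X'\<close> replaces \<open>X\<close> so that
    Fubini's theorem applies; the two agree on almost every path.\<close>
  define Z where "Z n \<omega> = (\<integral>\<^sup>+s\<in>{real (Suc n)..real (Suc n) + 1}. ennreal \<bar>X' s \<omega>\<bar> \<partial>lborel)
      / ennreal (real (Suc n))" for n \<omega>
  have Z_meas[measurable]: "Z n \<in> borel_measurable M" for n
    unfolding Z_def by measurable
  have EZ: "(\<integral>\<^sup>+\<omega>. Z n \<omega> \<partial>M) \<le> ennreal (K * (3 + real n) powr H / real (Suc n))" for n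
  proof -
    let ?J = "{real (Suc n)..real (Suc n) + 1}"
    have "(\<integral>\<^sup>+\<omega>. (\<integral>\<^sup>+s\<in>?J. ennreal \<bar>X' s \<omega>\<bar> \<partial>lborel) \<partial>M)
        = (\<integral>\<^sup>+s. (\<integral>\<^sup>+\<omega>. ennreal \<bar>X' s \<omega>\<bar> * indicator ?J s \<partial>M) \<partial>lborel)"
      by (rule P.Fubini') measurable
    also have "\<dots> \<le> (\<integral>\<^sup>+s. ennreal (K * (3 + real n) powr H) * indicator ?J s \<partial>lborel)"
    proof (rule nn_integral_mono)
      fix s :: real
      show "(\<integral>\<^sup>+\<omega>. ennreal \<bar>X' s \<omega>\<bar> * indicator ?J s \<partial>M)
          \<le> ennreal (K * (3 + real n) powr H) * indicator ?J s"
      proof (cases "s \<in> ?J")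
        case True
        then have s: "s > 0" "s \<le> 2 + real n" by auto
        have "(\<integral>\<^sup>+\<omega>. ennreal \<bar>X' s \<omega>\<bar> \<partial>M) = (\<integral>\<^sup>+\<omega>. ennreal \<bar>X s \<omega>\<bar> \<partial>M)"
          using cont s by (intro nn_integral_cong_AE) (auto simp: eq elim!: eventually_mono)
        also have "\<dots> \<le> ennreal (K * (1 + s) powr H)"
          by (rule moment[OF s(1)])
        also have "\<dots> \<le> ennreal (K * (3 + real n) powr H)"
          using s K H by (intro ennreal_leI mult_left_mono powr_mono2) auto
        finally show ?thesis using True by simp
      qed simp
    qed
    also have "\<dots> = ennreal (K * (3 + real n) powr H)"
      by (subst nn_integral_cmult_indicator) auto
    finally have "(\<integral>\<^sup>+\<omega>. (\<integral>\<^sup>+s\<in>?J. ennreal \<bar>X' s \<omega>\<bar> \<partial>lborel) \<partial>M) / ennreal (real (Suc n))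
        \<le> ennreal (K * (3 + real n) powr H) / ennreal (real (Suc n))"
      by (rule divide_right_mono_ennreal)
    also have "\<dots> = ennreal (K * (3 + real n) powr H / real (Suc n))"
      using K by (intro divide_ennreal) auto
    finally show ?thesis
      unfolding Z_def by (subst nn_integral_divide) (auto, measurable)
  qed
  have lim: "(\<lambda>n. ennreal (K * (3 + real n) powr H / real (Suc n))) \<longlonglongrightarrow> ennreal 0"
    using H by (intro tendsto_ennrealI) real_asymp
  have "(\<integral>\<^sup>+\<omega>. liminf (\<lambda>n. Z n \<omega>) \<partial>M) \<le> liminf (\<lambda>n. \<integral>\<^sup>+\<omega>. Z n \<omega> \<partial>M)"
    by (rule nn_integral_liminf) measurable
  also have "\<dots> \<le> liminf (\<lambda>n. ennreal (K * (3 + real n) powr H / real (Suc n)))"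
    using EZ by (intro Liminf_mono) auto
  also have "\<dots> = 0"
    using lim_imp_Liminf[OF _ lim] by simp
  finally have "AE \<omega> in M. liminf (\<lambda>n. Z n \<omega>) = 0"
    by (simp add: nn_integral_0_iff_AE)
  with cont show ?thesis
  proof eventually_elim
    case (elim \<omega>)
    show ?case
    proof
      assume "\<exists>C. \<forall>n. b * real n - C \<le> integral {real (Suc n)..real (Suc n) + 1} (\<lambda>s. \<bar>X s \<omega>\<bar>)"
      then obtain C where C: "\<And>n. b * real n - C
          \<le> integral {real (Suc n)..real (Suc n) + 1} (\<lambda>s. \<bar>X s \<omega>\<bar>)"
        by blast
      have le: "ennreal ((b * real n - C) / real (Suc n)) \<le> Z n \<omega>" for n
      proof -
        let ?J = "{real (Suc n)..real (Suc n) + 1}"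
        have int: "set_integrable lborel ?J (\<lambda>s. \<bar>X s \<omega>\<bar>)"
          by (intro borel_integrable_atLeastAtMost' continuous_intros continuous_on_subset[OF elim(1)]) auto
        have "ennreal (b * real n - C) \<le> ennreal (LINT s:?J|lborel. \<bar>X s \<omega>\<bar>)"
          using C[of n] set_borel_integral_eq_integral(2)[OF int] by (intro ennreal_leI) simp
        also have "\<dots> = (\<integral>\<^sup>+s\<in>?J. ennreal \<bar>X s \<omega>\<bar> \<partial>lborel)"
          using int unfolding set_integrable_def set_lebesgue_integral_def
          by (subst nn_integral_eq_integral[symmetric])
            (auto intro!: nn_integral_cong simp: indicator_def)
        also have "\<dots> = (\<integral>\<^sup>+s\<in>?J. ennreal \<bar>X' s \<omega>\<bar> \<partial>lborel)"
          using elim(1) by (intro nn_integral_cong) (auto simp: eq indicator_def)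
        finally have "ennreal (b * real n - C) / ennreal (real (Suc n)) \<le> Z n \<omega>"
          unfolding Z_def by (rule divide_right_mono_ennreal)
        \<comment> \<open>If \<open>b * real n - C\<close> is negative, \<open>ennreal\<close>
          truncates the quotient to 0 and the bound is trivial.\<close>
        then show ?thesis
          by (cases "b * real n - C \<ge> 0")
            (simp_all add: divide_ennreal[symmetric] ennreal_neg divide_le_0_iff del: of_nat_Suc)
      qed
      have "(\<lambda>n. (b * real n - C) / real (Suc n)) \<longlonglongrightarrow> b"
        by real_asymp
      then have "(\<lambda>n. ennreal ((b * real n - C) / real (Suc n))) \<longlonglongrightarrow> ennreal b"
        by (rule tendsto_ennrealI)
      then have "ennreal b = liminf (\<lambda>n. ennreal ((b * real n - C) / real (Suc n)))"
        using lim_imp_Liminf[of sequentially] by (metis sequentially_bot)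
      also have "\<dots> \<le> liminf (\<lambda>n. Z n \<omega>)"
        using le by (intro Liminf_mono) auto
      finally show False
        using elim(2) b by simp
    qed
  qed
qed

section \<open>Sign and growth estimates along a global weak solution\<close>

text \<open>Continuity of \<open>t \<mapsto> \<integral> v(t) \<psi>\<close> together with the constant sign of \<open>v(t)\<close> on the
  connected set \<open>D\<close> excludes that \<open>v\<close> jumps to negative values.\<close>

lemma nonvanishing_field_pos:
  fixes v :: "real \<Rightarrow> 'a::euclidean_space \<Rightarrow> real"
  assumes D: "open D" "D \<noteq> {}" "bounded D" "connected D"
    and w: "set_integrable lborel D w" "\<And>x. x \<in> D \<Longrightarrow> w x > 0" "(LINT x:D|lborel. w x) = 1"
    and v: "\<And>t. t > 0 \<Longrightarrow> continuous_on (closure D) (v t)"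
      "\<And>t x. t > 0 \<Longrightarrow> x \<in> closure D \<Longrightarrow> v t x \<noteq> 0"
    and e: "\<And>T. continuous_on {0..T} (\<lambda>t. LINT x:D|lborel. v t x * w x)"
      "(LINT x:D|lborel. v 0 x * w x) > 0"
    and t: "t > 0" and x: "x \<in> closure D"
  shows "v t x > 0"
proof -
  define e where "e t = (LINT x:D|lborel. v t x * w x)" for t
  have sign: "(\<forall>x\<in>closure D. v s x > 0) \<or> (\<forall>x\<in>closure D. v s x < 0)" if "s > 0" for s
  proof (rule ccontr)
    assume "\<not> ?thesis"
    then obtain x y where xy: "x \<in> closure D" "y \<in> closure D" "v s x \<le> 0" "v s y \<ge> 0"
      by (meson not_le)
    have "connected (v s ` closure D)"
      using D(4) v(1)[OF that] by (intro connected_continuous_image connected_imp_connected_closure) auto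
    then have "0 \<in> v s ` closure D"
      using xy by (meson connected_iff_interval imageI)
    then show False
      using v(2)[OF that] by auto
  qed
  have neg: "e s < 0" if "s > 0" "\<forall>x\<in>closure D. v s x < 0" for s
  proof -
    have "(LINT x:D|lborel. - v s x * w x) > 0"
      using that v(1) by (intro jensen_inverse_square(1) D w continuous_intros) auto
    then show ?thesis
      by (simp add: e_def set_integral_uminus set_lebesgue_integral_def)
  qed
  have nz: "e s \<noteq> 0" if "s > 0" for s
    using sign[OF that]
  proof
    assume "\<forall>x\<in>closure D. v s x > 0"
    then have "e s > 0"
      unfolding e_def using that by (intro jensen_inverse_square(1) D w v(1)) auto
    then show ?thesis by simp
  qed (use neg[OF that] in auto)
  have "e t \<ge> 0"
  \<comment> \<open>A negative \<open>e t\<close> would give \<open>e\<close> a zero in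
    \<open>{0..t}\<close>: time 0 is excluded by the initial value, positive times by
    \<open>nz\<close>.\<close>
  proof (rule ccontr)
    assume "\<not> e t \<ge> 0"
    then obtain s where "0 \<le> s" "s \<le> t" "e s = 0"
      using IVT2'[of e t 0 0] e(1)[of t] e(2) t unfolding e_def by auto
    then show False
      using nz[of s] e(2) by (cases "s = 0") (auto simp: e_def)
  qed
  then show ?thesis
    using neg[OF t] sign[OF t] x by (auto simp: not_less[symmetric])
qed

lemma C_k_on_imp_continuous_on: "C_k_on n h S \<Longrightarrow> continuous_on S h"
  by (cases n) (auto intro: differentiable_imp_continuous_on)

text \<open>Testing with the eigenfunction turns the Laplacian into multiplication by
  \<open>- chi\<close>, and Jensen's inequality closes the resulting equation for \<open>e\<close>.
  The decay lemma with \<open>Y s = exp (3 * N 1 s)\<close> then makes the unit-interval integrals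
  of \<open>Y\<close> exponentially small, which is possible only if \<open>3 * N 1\<close> is large
  in mean.\<close>

lemma global_solution_noise_growth:
  fixes D :: "'a::euclidean_space set" and g :: "nat \<Rightarrow> 'a \<Rightarrow> real"
  assumes domain: "smooth_bounded_domain D"
    and lam: "lam 1 1 > 0" "lam 1 2 > 0"
    and g: "continuous_on D (g 1)" "\<And>x. x \<in> D \<Longrightarrow> 0 < g 1 x \<and> g 1 x \<le> 1"
    and eigen: "robin_principal_eigenpair D \<nu> \<beta> chi \<psi>"
    and N: "continuous_on {0..} (N 1)"
    and sol: "weak_solution_path D \<nu> \<beta> lam k g N \<infinity> z"
    and nz: "\<And>t. t > 0 \<Longrightarrow> 0 < min_abs_on_closure D (z 1 t)"
  shows "\<exists>C. \<forall>n. 3 * ln (1 + (chi + (k 1 1)\<^sup>2 / 2)) * real n - C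
    \<le> integral {real (Suc n)..real (Suc n) + 1} (\<lambda>s. \<bar>3 * N 1 s\<bar>)"
proof -
  have D: "open D" "D \<noteq> {}" "bounded D" "connected D"
    using domain by (auto simp: smooth_bounded_domain_def)
  have psi: "robin_C2 D \<nu> \<beta> \<psi>" "\<And>x. x \<in> D \<Longrightarrow> \<psi> x > 0" "(LINT x:D|lborel. \<psi> x) = 1"
    and lap: "\<And>x. x \<in> D \<Longrightarrow> laplacian \<psi> x = - (chi * \<psi> x)" and chi: "chi > 0"
    using eigen unfolding robin_principal_eigenpair_def robin_eigenpair_def minus_equation_iff[of "laplacian _ _"]
    by metis+
  \<comment> \<open>The Bochner integral of a nonintegrable function is 0, so the normalisation to 1
    yields integrability.\<close>
  have psi_int: "set_integrable lborel D \<psi>"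
    using psi(3) not_integrable_integral_eq[of lborel "\<lambda>x. indicator D x *\<^sub>R \<psi> x"]
    unfolding set_integrable_def set_lebesgue_integral_def by (metis zero_neq_one)
  have lt: "(ennreal t < \<infinity>) = True" for t
    by simp
  obtain v where zv_all: "\<forall>i\<in>{1,2}. \<forall>t\<ge>0. \<forall>x\<in>closure D. z i t x = exp (- N i t) * v i t x"
    and weak: "\<forall>i\<in>{1,2}. \<forall>j\<in>{1,2} - {i}. \<forall>\<phi>. robin_C2 D \<nu> \<beta> \<phi> \<longrightarrow> (\<forall>t\<ge>0.
           set_integrable lborel {0..t}
             (\<lambda>s. LINT x:D|lborel. v i s x * (laplacian \<phi> x - (k i 1)\<^sup>2 / 2 * \<phi> x)) \<and>
           set_integrable lborel {0..t}
             (\<lambda>s. exp (3 * N i s) * (LINT x:D|lborel. \<phi> x / (v i s x)\<^sup>2)) \<and>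
           set_integrable lborel {0..t}
             (\<lambda>s. exp (N i s + 2 * N j s) * (LINT x:D|lborel. \<phi> x / (v j s x)\<^sup>2)) \<and>
           (LINT x:D|lborel. v i t x * \<phi> x) =
             (LINT x:D|lborel. g i x * \<phi> x)
             + (LINT s:{0..t}|lborel.
                  LINT x:D|lborel. v i s x * (laplacian \<phi> x - (k i 1)\<^sup>2 / 2 * \<phi> x))
             - lam i 1 * (LINT s:{0..t}|lborel.
                  exp (3 * N i s) * (LINT x:D|lborel. \<phi> x / (v i s x)\<^sup>2))
             - lam i 2 * (LINT s:{0..t}|lborel.
                  exp (N i s + 2 * N j s) * (LINT x:D|lborel. \<phi> x / (v j s x)\<^sup>2)))"
    using sol unfolding weak_solution_path_def lt simp_thms
    by (elim conjE exE) (rule that, assumption+)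
  have z_cont: "continuous_on (closure D) (z 1 t)" if "t > 0" for t
    using sol that unfolding weak_solution_path_def lt simp_thms by blast
  have zv: "z 1 t x = exp (- N 1 t) * v 1 t x" if "t \<ge> 0" "x \<in> closure D" for t x
    using zv_all that by blast
  define \<kappa> where "\<kappa> = chi + (k 1 1)\<^sup>2 / 2"
  have kappa: "\<kappa> > 0"
    using chi by (simp add: \<kappa>_def add_pos_nonneg)
  define e where "e t = (LINT x:D|lborel. v 1 t x * \<psi> x)" for t
  define P where "P s = exp (3 * N 1 s) * (LINT x:D|lborel. \<psi> x / (v 1 s x)\<^sup>2)" for s
  define Q where "Q s = exp (N 1 s + 2 * N 2 s) * (LINT x:D|lborel. \<psi> x / (v 2 s x)\<^sup>2)" for s
  \<comment> \<open>This is the total loss rate: together with \<open>drift\<close>, the weak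
    formulation says that \<open>e\<close> is its initial value minus the integral of
    \<open>p\<close>.\<close>
  define p where "p s = \<kappa> * e s + lam 1 1 * P s + lam 1 2 * Q s" for s
  have drift: "(LINT x:D|lborel. v 1 s x * (laplacian \<psi> x - (k 1 1)\<^sup>2 / 2 * \<psi> x)) = - \<kappa> * e s" for s
  proof -
    have "(LINT x:D|lborel. v 1 s x * (laplacian \<psi> x - (k 1 1)\<^sup>2 / 2 * \<psi> x))
        = (LINT x:D|lborel. - \<kappa> * (v 1 s x * \<psi> x))"
      using D(1) by (intro set_lebesgue_integral_cong) (auto simp: lap \<kappa>_def algebra_simps)
    then show ?thesis by (simp only: e_def set_integral_mult_right)
  qed
  \<comment> \<open>The weak formulation for \<open>i = 1\<close>, \<open>j = 2\<close> and the test
    function \<open>\<psi>\<close>.\<close>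
  have w: "set_integrable lborel {0..t} (\<lambda>s. - \<kappa> * e s)" "set_integrable lborel {0..t} P"
    "set_integrable lborel {0..t} Q"
    "e t = (LINT x:D|lborel. g 1 x * \<psi> x) + (LINT s:{0..t}|lborel. - \<kappa> * e s)
        - lam 1 1 * (LINT s:{0..t}|lborel. P s) - lam 1 2 * (LINT s:{0..t}|lborel. Q s)"
    if "t \<ge> 0" for t
    using bspec[OF bspec[OF weak, of 1], of 2, THEN spec, THEN mp, OF _ _ psi(1), THEN spec, THEN mp, OF _ _ that]
    unfolding drift P_def[symmetric] Q_def[symmetric] e_def[symmetric] by simp_all
  have p_int: "p integrable_on {0..t}" and e_eq: "e t = (LINT x:D|lborel. g 1 x * \<psi> x) - integral {0..t} p"
    if t: "t \<ge> 0" for t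
  proof -
    have 1: "set_integrable lborel {0..t} (\<lambda>s. \<kappa> * e s)"
      using set_integrable_mult_right[of "- 1 :: real", OF w(1)[OF t]] by simp
    have pI: "set_integrable lborel {0..t} p"
      unfolding p_def using 1 w(2,3)[OF t] by (intro set_integral_add) auto
    show "p integrable_on {0..t}"
      by (rule set_borel_integral_eq_integral(1)[OF pI])
    have "(LINT s:{0..t}|lborel. p s) = (LINT s:{0..t}|lborel. \<kappa> * e s)
        + lam 1 1 * (LINT s:{0..t}|lborel. P s) + lam 1 2 * (LINT s:{0..t}|lborel. Q s)"
      unfolding p_def using 1 w(2,3)[OF t] by (simp add: set_integral_add)
    moreover have "(LINT s:{0..t}|lborel. - \<kappa> * e s) = - \<kappa> * (LINT s:{0..t}|lborel. e s)"
      by (rule set_integral_mult_right)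
    ultimately show "e t = (LINT x:D|lborel. g 1 x * \<psi> x) - integral {0..t} p"
      using w(4)[OF t] set_borel_integral_eq_integral(2)[OF pI] by simp
  qed
  have G: "(LINT x:D|lborel. g 1 x * \<psi> x) > 0"
  proof (intro set_integral_pos set_integrable_bounded_continuous_mult[where c = 1] D g(1) psi_int)
    show "\<bar>g 1 x\<bar> \<le> 1" "0 < g 1 x * \<psi> x" if "x \<in> D" for x
      using g(2)[OF that] psi(2)[OF that] by auto
  qed
  \<comment> \<open>Continuity in time comes from the weak formulation: \<open>e\<close> is a
    constant minus an indefinite integral.\<close>
  have e_cont: "continuous_on {0..T} e" for T
  proof (cases "T \<ge> 0")
    case True
    have "continuous_on {0..T} (\<lambda>t. (LINT x:D|lborel. g 1 x * \<psi> x) - integral {0..t} p)"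
      by (intro continuous_intros indefinite_integral_continuous_1 p_int True)
    then show ?thesis
      by (rule continuous_on_eq) (simp add: e_eq)
  qed simp
  have v_cont: "continuous_on (closure D) (v 1 t)" if "t > 0" for t
  proof -
    have "continuous_on (closure D) (\<lambda>x. exp (N 1 t) * z 1 t x)"
      using z_cont[OF that] by (intro continuous_intros)
    then show ?thesis
    proof (rule continuous_on_eq)
      show "exp (N 1 t) * z 1 t x = v 1 t x" if "x \<in> closure D" for x
        using zv[of t x] that \<open>t > 0\<close> by (simp add: exp_minus)
    qed
  qed
  have v_nz: "v 1 t x \<noteq> 0" if "t > 0" "x \<in> closure D" for t x
  proof -
    have "min_abs_on_closure D (z 1 t) \<le> \<bar>z 1 t x\<bar>"
      unfolding min_abs_on_closure_def using that by (intro cINF_lower bdd_belowI2[of _ 0]) auto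
    with nz[OF that(1)] zv[of t x] that show ?thesis by auto
  qed
  have v_pos: "v 1 t x > 0" if "t > 0" "x \<in> closure D" for t x
    using D psi_int psi(2,3) v_cont v_nz e_cont e_eq[of 0] G that unfolding e_def
    by (intro nonvanishing_field_pos[where v = "v 1" and D = D and w = \<psi>]) auto
  have e_pos: "e t > 0" if "t \<ge> 0" for t
  proof (cases "t = 0")
    case False
    with that have "t > 0" by simp
    then show ?thesis
      unfolding e_def by (intro jensen_inverse_square(1) D psi_int psi v_cont v_pos)
  qed (use e_eq[of 0] G in simp)
  have bound: "\<kappa> * e s + lam 1 1 * exp (3 * N 1 s) / (e s)\<^sup>2 \<le> p s" if "s > 0" for s
  proof -
    have P: "exp (3 * N 1 s) * (1 / (e s)\<^sup>2) \<le> P s"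
      unfolding P_def e_def using that
      by (intro mult_left_mono jensen_inverse_square(2) D psi_int psi v_cont v_pos) auto
    \<comment> \<open>The coupling term only helps, so its sign is enough. The square makes the
      integrand nonnegative whatever the sign of \<open>v 2\<close>.\<close>
    have Q: "Q s \<ge> 0"
      unfolding Q_def set_lebesgue_integral_def using less_imp_le[OF psi(2)]
      by (intro mult_nonneg_nonneg integral_nonneg_AE AE_I2)
        (auto simp: indicator_def intro!: divide_nonneg_nonneg)
    have "lam 1 1 * (exp (3 * N 1 s) * (1 / (e s)\<^sup>2)) \<le> lam 1 1 * P s" "0 \<le> lam 1 2 * Q s"
      using mult_left_mono[OF P less_imp_le[OF lam(1)]] mult_nonneg_nonneg[OF less_imp_le[OF lam(2)] Q]
      by simp_all
    then show ?thesis by (simp add: p_def)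
  qed
  obtain C where C: "\<And>n. exp (3 * ln (1 + \<kappa>) * real n)
      * integral {real (Suc n)..real (Suc n) + 1} (\<lambda>s. exp (3 * N 1 s)) \<le> C"
  proof (rule dissipation_integral_decay[OF kappa lam(1) p_int e_eq e_pos bound])
    show "continuous_on {0..} (\<lambda>s. exp (3 * N 1 s))"
      by (intro continuous_intros N)
  qed auto
  have "3 * ln (1 + \<kappa>) * real n - C \<le> integral {real (Suc n)..real (Suc n) + 1} (\<lambda>s. \<bar>3 * N 1 s\<bar>)" for n
  proof -
    let ?J = "{real (Suc n)..real (Suc n) + 1}" and ?b = "3 * ln (1 + \<kappa>) * real n"
    have N': "continuous_on ?J (N 1)"
      by (rule continuous_on_subset[OF N]) auto
    have i1: "(\<lambda>s. \<bar>3 * N 1 s\<bar>) integrable_on ?J" and i2: "(\<lambda>s. exp (3 * N 1 s)) integrable_on ?J"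
      by (intro integrable_continuous_interval continuous_intros N')+
    have "((\<lambda>s. ?b - \<bar>3 * N 1 s\<bar>) has_integral (?b - integral ?J (\<lambda>s. \<bar>3 * N 1 s\<bar>))) ?J"
      using has_integral_diff[OF has_integral_const_real[of ?b "real (Suc n)" "real (Suc n) + 1"]
          integrable_integral[OF i1]] by simp
    moreover have "((\<lambda>s. exp ?b * exp (3 * N 1 s)) has_integral
        (exp ?b * integral ?J (\<lambda>s. exp (3 * N 1 s)))) ?J"
      by (intro has_integral_mult_right integrable_integral i2)
    \<comment> \<open>Pointwise, \<open>?b - \<bar>3 * N 1 s\<bar> \<le> ?b + 3 * N 1 s \<le> exp
      (?b + 3 * N 1 s)\<close>. This converts exponential smallness into linear growth.\<close>
    ultimately have "?b - integral ?J (\<lambda>s. \<bar>3 * N 1 s\<bar>) \<le> exp ?b * integral ?J (\<lambda>s. exp (3 * N 1 s))"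
    proof (rule has_integral_le)
      fix s
      show "?b - \<bar>3 * N 1 s\<bar> \<le> exp ?b * exp (3 * N 1 s)"
        using exp_ge_add_one_self[of "?b + 3 * N 1 s"] by (simp only: exp_add)
    qed
    with C[of n] show ?thesis by linarith
  qed
  then show ?thesis
    unfolding \<kappa>_def by blast
qed

section \<open>Almost sure quenching and the probability bound\<close>

theorem theorem5p5:
  fixes D :: "(real ^ 'd) set"
    and \<nu> :: "real ^ 'd \<Rightarrow> real ^ 'd"
    and \<beta> chi \<rho>11 \<rho>12 \<rho>21 \<rho>22 \<rho>1 \<rho>2 ksq E0 lamt U H \<alpha> :: real
    and lam k :: "nat \<Rightarrow> nat \<Rightarrow> real"
    and f g :: "nat \<Rightarrow> real ^ 'd \<Rightarrow> real"
    and \<psi> :: "real ^ 'd \<Rightarrow> real"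
    and M :: "'w measure"
    and F :: "ennreal \<Rightarrow> 'w measure"
    and W B :: "real \<Rightarrow> 'w \<Rightarrow> real"
    and z :: "nat \<Rightarrow> real \<Rightarrow> real ^ 'd \<Rightarrow> 'w \<Rightarrow> real"
    and \<tau> :: "'w \<Rightarrow> ennreal"
  assumes domain: "smooth_bounded_domain D" "outward_unit_normal D \<nu>"
    and positive: "\<beta> > 0"
      "\<And>i l. i \<in> {1,2} \<Longrightarrow> l \<in> {1,2} \<Longrightarrow> lam i l > 0"
      "\<And>i l. i \<in> {1,2} \<Longrightarrow> l \<in> {1,2} \<Longrightarrow> k i l > 0"
    and initial: "\<And>i. i \<in> {1,2} \<Longrightarrow> C_k_on 2 (f i) D"
      "\<And>i x. i \<in> {1,2} \<Longrightarrow> x \<in> D \<Longrightarrow> 0 \<le> f i x \<and> f i x < 1"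
      "\<And>i. i \<in> {1,2} \<Longrightarrow> \<exists>x\<in>D. f i x \<noteq> 0"
      "\<And>i x. i \<in> {1,2} \<Longrightarrow> x \<in> D \<Longrightarrow> g i x = 1 - f i x"
    and params: "k 2 1 + 2 * k 1 1 = 3 * k 1 1" "3 * k 1 1 = \<rho>11"
      "k 2 2 + 2 * k 1 2 = 3 * k 1 2" "3 * k 1 2 = \<rho>12"
      "k 1 1 + 2 * k 2 1 = 3 * k 2 1" "3 * k 2 1 = \<rho>21"
      "k 1 2 + 2 * k 2 2 = 3 * k 2 2" "3 * k 2 2 = \<rho>22"
      "\<rho>11 = \<rho>1" "\<rho>21 = \<rho>1" "\<rho>12 = \<rho>2" "\<rho>22 = \<rho>2"
    and eigen: "robin_principal_eigenpair D \<nu> \<beta> chi \<psi>"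
    and ksq: "ksq = min ((k 1 1)\<^sup>2 / 2) ((k 2 1)\<^sup>2 / 2)"
    and E0: "E0 = (LINT x:D|lborel. (g 1 x + g 2 x) * \<psi> x)"
    and lamt: "lamt = min (lam 1 1 + lam 2 2) (lam 1 2 + lam 2 1)"
    and U: "U = E0 ^ 3 / (12 * lamt)"
    and prob: "prob_space M" "filtration (space M) F" "\<And>t. sets (F t) \<subseteq> sets M"
    and hurst: "1/2 < H" "H < 1"
    and noise: "standard_brownian_motion M F W"
      "fractional_brownian_motion M H B" "volterra_representation M W H B"
    and solution: "AE \<omega> in M. weak_solution_path D \<nu> \<beta> lam k g
        (\<lambda>i t. mixed_noise k W B i t \<omega>) (\<tau> \<omega>) (\<lambda>i t x. z i t x \<omega>)"
    and quenching: "quenching_time M F D z \<tau>"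
    and alpha: "H < \<alpha>" "\<alpha> < 1"
  shows "ereal (measure M {\<omega> \<in> space M. \<tau> \<omega> < \<infinity>}) \<ge>
    1 - exp_ereal (-
      (ereal (\<alpha>\<^sup>2) * (enn2ereal (L1 M W B (chi + ksq) \<rho>1 \<rho>2 U \<alpha>) - 1)\<^sup>2
       / ereal (\<rho>1\<^sup>2 * (2 * \<alpha> - 1) powr (2 - 1 / \<alpha>) * ln (U + 1) powr (1 / \<alpha> - 2)
           + 2 * \<rho>2\<^sup>2 * \<alpha>\<^sup>2 * ln (U + 1) powr (2 * H / \<alpha> - 2)
               * ((\<alpha> - H) / \<alpha>) powr (2 - 2 * H / \<alpha>))))"
proof -
  interpret prob_space M by (rule prob(1))
  let ?X = "\<lambda>t \<omega>. 3 * mixed_noise k W B 1 t \<omega>"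
  have k1: "k 1 1 > 0" "k 1 2 > 0"
    using positive(3)[of 1 1] positive(3)[of 1 2] by simp_all
  have lam1: "lam 1 1 > 0" "lam 1 2 > 0"
    using positive(2)[of 1 1] positive(2)[of 1 2] by simp_all
  have chi: "chi > 0"
    using eigen by (simp add: robin_principal_eigenpair_def)
  have space_F: "space (F t) = space M" for t
    using prob(2) by (simp add: filtration_def)
  have sub: "h \<in> borel_measurable M" if "h \<in> borel_measurable (F t)" for h :: "'w \<Rightarrow> real" and t
  proof -
    have "subalgebra M (F t)"
      unfolding subalgebra_def using space_F prob(3) by blast
    then show ?thesis
      using that by (rule measurable_from_subalg)
  qed
  have W_meas: "W t \<in> borel_measurable M" if "t \<ge> 0" for t
    using noise(1) that by (intro sub[of _ "ennreal t"]) (simp add: standard_brownian_motion_def)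
  have B_meas: "B t \<in> borel_measurable M" if "t \<ge> 0" for t
    using noise(2) that by (simp add: fractional_brownian_motion_def centred_gaussian_process_def)
  have X_meas: "?X t \<in> borel_measurable M" if "t \<ge> 0" for t
    using W_meas[OF that] B_meas[OF that] unfolding mixed_noise_def by measurable
  have cont: "AE \<omega> in M. continuous_on {0..} (\<lambda>t. mixed_noise k W B 1 t \<omega>)"
  proof -
    have "AE \<omega> in M. continuous_on {0..} (\<lambda>t. W t \<omega>)" "AE \<omega> in M. continuous_on {0..} (\<lambda>t. B t \<omega>)"
      using noise by (simp_all add: standard_brownian_motion_def fractional_brownian_motion_def)
    then show ?thesis
      unfolding mixed_noise_def by eventually_elim (intro continuous_intros)
  qed
  have W_mean: "(\<integral>\<^sup>+\<omega>. ennreal \<bar>W t \<omega>\<bar> \<partial>M) \<le> ennreal ((1 + t) powr H)" if t: "t > 0" for t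
  proof -
    have "distributed M lborel (\<lambda>\<omega>. W t \<omega> - W 0 \<omega>) (normal_density 0 (sqrt (t - 0)))"
      using noise(1) t unfolding standard_brownian_motion_def by blast
    then have "(\<integral>\<^sup>+\<omega>. ennreal \<bar>W t \<omega> - W 0 \<omega>\<bar> \<partial>M) \<le> ennreal (sqrt (t - 0))"
      using t by (intro normal_abs_moment_le) auto
    moreover have "AE \<omega> in M. W 0 \<omega> = 0"
      using noise(1) by (simp add: standard_brownian_motion_def)
    then have "(\<integral>\<^sup>+\<omega>. ennreal \<bar>W t \<omega> - W 0 \<omega>\<bar> \<partial>M) = (\<integral>\<^sup>+\<omega>. ennreal \<bar>W t \<omega>\<bar> \<partial>M)"
      by (intro nn_integral_cong_AE) (auto elim: eventually_mono)
    \<comment> \<open>Since \<open>H > 1/2\<close> and \<open>1 + t \<ge> 1\<close>, the Brownian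
      moment obeys the same bound as the fractional one.\<close>
    moreover have "sqrt t \<le> (1 + t) powr H"
    proof -
      have "sqrt t \<le> (1 + t) powr (1/2)"
        using t by (simp add: powr_half_sqrt)
      also have "\<dots> \<le> (1 + t) powr H"
        using t hurst by (intro powr_mono) auto
      finally show ?thesis .
    qed
    then have "ennreal (sqrt (t - 0)) \<le> ennreal ((1 + t) powr H)"
      by (intro ennreal_leI) simp
    ultimately show ?thesis
      by (metis (no_types, lifting) order_trans)
  qed
  have B_mean: "(\<integral>\<^sup>+\<omega>. ennreal \<bar>B t \<omega>\<bar> \<partial>M) \<le> ennreal ((1 + t) powr H)" if t: "t > 0" for t
  proof -
    have T: "finite {t}" "{t} \<subseteq> {0..}"
      using t by auto
    \<comment> \<open>The Gaussian property is used for the single time \<open>t\<close> with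
      coefficient 1; the covariance on the diagonal is \<open>t powr (2 * H)\<close>, which is
      nonzero, so the density case applies.\<close>
    have "distributed M lborel (\<lambda>\<omega>. B t \<omega>) (normal_density 0 (sqrt (t powr (2 * H))))"
      using noise(2) T t unfolding fractional_brownian_motion_def centred_gaussian_process_def Let_def
      by (auto dest!: spec[of _ "{t}"] spec[of _ "\<lambda>_. 1"])
    then have "(\<integral>\<^sup>+\<omega>. ennreal \<bar>B t \<omega>\<bar> \<partial>M) \<le> ennreal (sqrt (t powr (2 * H)))"
      using t by (intro normal_abs_moment_le) auto
    also have "sqrt (t powr (2 * H)) = t powr H"
      using t by (simp add: powr_half_sqrt[symmetric] powr_powr)
    also have "ennreal (t powr H) \<le> ennreal ((1 + t) powr H)"
      using t hurst by (intro ennreal_leI powr_mono2) auto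
    finally show ?thesis .
  qed
  \<comment> \<open>The slope is the one that a global path would force. The constant
    \<open>K\<close> adds the coefficients of \<open>W\<close> and \<open>B\<close> in
    \<open>?X\<close>, whose first absolute moments share one bound.\<close>
  have "AE \<omega> in M. \<not> (\<exists>C. \<forall>n. 3 * ln (1 + (chi + (k 1 1)\<^sup>2 / 2)) * real n - C
      \<le> integral {real (Suc n)..real (Suc n) + 1} (\<lambda>s. \<bar>?X s \<omega>\<bar>))"
  proof (rule sublinear_process_mean[where H = H and K = "3 * k 1 1 + 3 * k 1 2"])
    show "AE \<omega> in M. continuous_on {0..} (\<lambda>t. ?X t \<omega>)"
      using cont by eventually_elim (intro continuous_intros)
    show "0 < 3 * ln (1 + (chi + (k 1 1)\<^sup>2 / 2))"
      using chi by (simp add: add_pos_nonneg)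
    fix t :: real assume t: "t > 0"
    have [measurable]: "W t \<in> borel_measurable M" "B t \<in> borel_measurable M"
      using W_meas B_meas t by simp_all
    have "(\<integral>\<^sup>+\<omega>. ennreal \<bar>?X t \<omega>\<bar> \<partial>M)
        \<le> (\<integral>\<^sup>+\<omega>. ennreal (3 * k 1 1) * ennreal \<bar>W t \<omega>\<bar> + ennreal (3 * k 1 2) * ennreal \<bar>B t \<omega>\<bar> \<partial>M)"
    proof (rule nn_integral_mono)
      fix \<omega>
      have "\<bar>?X t \<omega>\<bar> \<le> 3 * k 1 1 * \<bar>W t \<omega>\<bar> + 3 * k 1 2 * \<bar>B t \<omega>\<bar>"
        using k1 abs_triangle_ineq[of "3 * k 1 1 * W t \<omega>" "3 * k 1 2 * B t \<omega>"]
        by (simp add: mixed_noise_def abs_mult algebra_simps)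
      then have "ennreal \<bar>?X t \<omega>\<bar> \<le> ennreal (3 * k 1 1 * \<bar>W t \<omega>\<bar> + 3 * k 1 2 * \<bar>B t \<omega>\<bar>)"
        by (rule ennreal_leI)
      also have "\<dots> = ennreal (3 * k 1 1) * ennreal \<bar>W t \<omega>\<bar> + ennreal (3 * k 1 2) * ennreal \<bar>B t \<omega>\<bar>"
        using k1 by (simp add: ennreal_plus ennreal_mult)
      finally show "ennreal \<bar>?X t \<omega>\<bar>
          \<le> ennreal (3 * k 1 1) * ennreal \<bar>W t \<omega>\<bar> + ennreal (3 * k 1 2) * ennreal \<bar>B t \<omega>\<bar>" .
    qed
    also have "\<dots> = ennreal (3 * k 1 1) * (\<integral>\<^sup>+\<omega>. ennreal \<bar>W t \<omega>\<bar> \<partial>M)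
        + ennreal (3 * k 1 2) * (\<integral>\<^sup>+\<omega>. ennreal \<bar>B t \<omega>\<bar> \<partial>M)"
      by (simp add: nn_integral_add nn_integral_cmult)
    also have "\<dots> \<le> ennreal (3 * k 1 1) * ennreal ((1 + t) powr H)
        + ennreal (3 * k 1 2) * ennreal ((1 + t) powr H)"
      by (intro add_mono mult_left_mono W_mean B_mean t) auto
    also have "\<dots> = ennreal ((3 * k 1 1 + 3 * k 1 2) * (1 + t) powr H)"
      using k1 by (simp add: ennreal_mult' ennreal_plus distrib_right)
    finally show "(\<integral>\<^sup>+\<omega>. ennreal \<bar>?X t \<omega>\<bar> \<partial>M)
        \<le> ennreal ((3 * k 1 1 + 3 * k 1 2) * (1 + t) powr H)" .
  qed (use X_meas hurst k1 in auto)
  \<comment> \<open>On \<open>\<tau> \<omega> = \<infinity>\<close> the path solves the system for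
    all times, so it would show exactly the growth just excluded.\<close>
  moreover have "AE \<omega> in M. \<tau> \<omega> = \<infinity> \<longrightarrow> (\<exists>C. \<forall>n. 3 * ln (1 + (chi + (k 1 1)\<^sup>2 / 2)) * real n - C
      \<le> integral {real (Suc n)..real (Suc n) + 1} (\<lambda>s. \<bar>?X s \<omega>\<bar>))"
  proof -
    have "AE \<omega> in M. \<forall>t>0. ennreal t < \<tau> \<omega> \<longrightarrow> 0 < min_abs_on_closure D (\<lambda>x. z 1 t x \<omega>)"
      using conjunct2[OF quenching[unfolded quenching_time_def]] by eventually_elim simp
    with solution cont show ?thesis
    proof eventually_elim
      case (elim \<omega>)
      show ?case
      proof
        assume inf: "\<tau> \<omega> = \<infinity>"
        have "continuous_on D (f 1)"
          using initial(1)[of 1] by (intro C_k_on_imp_continuous_on) auto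
        then have g: "continuous_on D (g 1)"
          by (subst continuous_on_cong[OF refl initial(4)]) (auto intro!: continuous_intros)
        show "\<exists>C. \<forall>n. 3 * ln (1 + (chi + (k 1 1)\<^sup>2 / 2)) * real n - C
            \<le> integral {real (Suc n)..real (Suc n) + 1} (\<lambda>s. \<bar>?X s \<omega>\<bar>)"
        proof (rule global_solution_noise_growth[where lam = lam and g = g and D = D
              and \<nu> = \<nu> and \<beta> = \<beta> and \<psi> = \<psi> and k = k and chi = chi
              and z = "\<lambda>i t x. z i t x \<omega>" and N = "\<lambda>i t. mixed_noise k W B i t \<omega>"])
          show "0 < g 1 x \<and> g 1 x \<le> 1" if "x \<in> D" for x
            using initial(2,4)[of 1 x] that by auto
          show "robin_principal_eigenpair D \<nu> \<beta> chi \<psi>"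
            by (rule eigen)
          show "weak_solution_path D \<nu> \<beta> lam k g (\<lambda>i t. mixed_noise k W B i t \<omega>) \<infinity>
              (\<lambda>i t x. z i t x \<omega>)"
            using elim(1) inf by simp
          show "0 < min_abs_on_closure D (\<lambda>x. z 1 t x \<omega>)" if "t > 0" for t
            using elim(3) inf that by simp
        qed (fact domain(1) lam1 g elim(2))+
      qed
    qed
  qed
  ultimately have fin: "AE \<omega> in M. \<tau> \<omega> < \<infinity>"
    by eventually_elim (auto simp: less_top)
  \<comment> \<open>A stopping time supplies the events \<open>\<tau> \<omega> \<le> t\<close>;
    finiteness of \<open>\<tau>\<close> is written as a countable union of them to obtain its
    measurability.\<close>
  have iff: "a < \<infinity> \<longleftrightarrow> (\<exists>n. a \<le> of_nat n)" for a :: ennreal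
  proof
    assume "a < \<infinity>"
    then obtain n where "a < of_nat n"
      using ennreal_Ex_less_of_nat[of a] by auto
    then show "\<exists>n. a \<le> of_nat n"
      by (auto intro: less_imp_le)
  next
    assume "\<exists>n. a \<le> of_nat n"
    then show "a < \<infinity>"
      using of_nat_less_top by (auto simp del: of_nat_less_top intro: order_le_less_trans)
  qed
  have "{\<omega> \<in> space M. \<tau> \<omega> < \<infinity>} = (\<Union>n::nat. {\<omega> \<in> space M. \<tau> \<omega> \<le> of_nat n})"
    unfolding iff by blast
  moreover have "{\<omega> \<in> space M. \<tau> \<omega> \<le> t} \<in> sets M" for t
  proof -
    have "Measurable.pred (F t) (\<lambda>\<omega>. \<tau> \<omega> \<le> t)"
      using quenching by (simp add: quenching_time_def stopping_time_def)
    then show ?thesis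
      using prob(3)[of t] unfolding pred_def space_F by blast
  qed
  ultimately have "{\<omega> \<in> space M. \<tau> \<omega> < \<infinity>} \<in> events"
    using sets.countable_UN[of "\<lambda>n. {\<omega> \<in> space M. \<tau> \<omega> \<le> of_nat n}" UNIV M] by (simp add: image_subset_iff)
  then have one: "measure M {\<omega> \<in> space M. \<tau> \<omega> < \<infinity>} = 1"
    using fin by (simp add: prob_Collect_eq_1)
  \<comment> \<open>The bound holds for every extended real argument, so an infinite value of
    \<open>L1\<close> is covered.\<close>
  have "1 - exp_ereal x \<le> ereal 1" for x
    using exp_ereal_nonneg[of x] by (cases "exp_ereal x") (auto simp: one_ereal_def)
  then show ?thesis
    unfolding one .
qed

end
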